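(* Let $n\geq 3$ be a positive integer and let $R\cong \prod_{i=1}^{n}\mathbb{F}_{i}$, where $\mathbb{F}_{i}$ is a field for every $1\leq i\leq n$. Then the following statements hold. 1) $V(In(R))=V(In(R)_{SR})$. 2) For distinct $I,J\in V(In(R)_{SR})$: $IJ\in E(In(R)_{SR})$ if and only if either $I=J^{c}$, or both $IJ\notin E(In(R))$ and $IJ^{c}\notin E(In(R))$.
   Context: For a commutative ring $R$ with identity, the inclusion ideal graph $In(R)$ is the simple graph whose vertices are all non-trivial ideals of $R$ (ideals different from $0$ and $R$), two distinct vertices being adjacent if and only if one of them is properly contained in the other. For a graph $G$, $V(G)$ and $E(G)$ denote the vertex and edge sets, and $uv\in E(G)$ means that $u$ and $v$ are adjacent in $G$ (so $IJ$ denotes a pair of vertices, not a product of ideals). $N(u)$ is the open neighborhood of $u$ and $d$ the distance in $G$. Two different vertices $u,v$ of $G$ are mutually maximally distant if $d(v,w)\leq d(u,v)$ for every $w\in N(u)$ and $d(u,w)\leq d(u,v)$ for every $w\in N(v)$. The strong resolving graph $G_{SR}$ has as vertices those $u\in V(G)$ for which there is some $v\in V(G)$ such that $u,v$ are mutually maximally distant, and $uv\in E(G_{SR})$ if and only if $u$ and $v$ are mutually maximally distant in $G$. Every ideal of $R=\prod_{i=1}^n\mathbb{F}_i$ has the form $I=I_1\times\cdots\times I_n$ with each $I_i\in\{0,\mathbb{F}_i\}$. For a vertex $I$, $I^{c}=I_1^c\times\cdots\times I_n^c$ is the vertex with $I_i^c=\mathbb{F}_i$ if and only if $I_i=0$.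 *)

theory Defs
  imports
    "HOL-Algebra.Chinese_Remainder"
    "Graph_Theory.Pair_Digraph"
    "Graph_Theory.Shortest_Path"
begin

text \<open>
  An undirected simple graph is represented as a symmetric, loop-free digraph without parallel
  arcs (\<^locale>\<open>pair_bidirected_digraph\<close>): the edge \<open>uv\<close> is the pair of arcs \<open>(u, v)\<close>, \<open>(v, u)\<close>.
\<close>

definition neighborhood :: "'v pair_pre_digraph \<Rightarrow> 'v \<Rightarrow> 'v set" where
  "neighborhood G u = {w. (u, w) \<in> parcs G}"

text \<open>The number of edges of a shortest walk; it is \<open>\<infinity>\<close> if there is no walk from \<open>u\<close> to \<open>v\<close>.\<close>

definition graph_dist :: "'v pair_pre_digraph \<Rightarrow> 'v \<Rightarrow> 'v \<Rightarrow> ereal" where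
  "graph_dist G u v = wf_digraph.\<mu> (with_proj G) (\<lambda>_. 1) u v"

definition mutually_maximally_distant :: "'v pair_pre_digraph \<Rightarrow> 'v \<Rightarrow> 'v \<Rightarrow> bool" where
  "mutually_maximally_distant G u v \<longleftrightarrow>
     u \<in> pverts G \<and> v \<in> pverts G \<and> u \<noteq> v \<and>
     (\<forall>w \<in> neighborhood G u. graph_dist G v w \<le> graph_dist G u v) \<and>
     (\<forall>w \<in> neighborhood G v. graph_dist G u w \<le> graph_dist G u v)"

definition strong_resolving_graph :: "'v pair_pre_digraph \<Rightarrow> 'v pair_pre_digraph" where
  "strong_resolving_graph G =
     \<lparr> pverts = {u \<in> pverts G. \<exists>v \<in> pverts G. mutually_maximally_distant G u v},
       parcs = {(u, v). mutually_maximally_distant G u v} \<rparr>"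

definition inclusion_ideal_graph :: "('a, 'm) ring_scheme \<Rightarrow> 'a set pair_pre_digraph" where
  "inclusion_ideal_graph R =
     (let V = {I. ideal I R \<and> I \<noteq> {\<zero>\<^bsub>R\<^esub>} \<and> I \<noteq> carrier R}
      in \<lparr> pverts = V, parcs = {(I, J). I \<in> V \<and> J \<in> V \<and> (I \<subset> J \<or> J \<subset> I)} \<rparr>)"

lemma pair_bidirected_digraph_inclusion_ideal_graph:
  "pair_bidirected_digraph (inclusion_ideal_graph R)"
  by unfold_locales
    (auto simp: inclusion_ideal_graph_def Let_def symmetric_def intro!: symI)

text \<open>
  If \<open>I = I\<^sub>0 \<times> \<dots> \<times> I\<^sub>n\<^sub>-\<^sub>1\<close> is an ideal of the product of the rings in the list \<open>Fs\<close>, whose elements are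
  lists of length \<open>n\<close>, then \<open>I\<^sub>i\<close> is recovered as the projection of \<open>I\<close> to the coordinate \<open>i\<close>.
\<close>

definition component :: "nat \<Rightarrow> 'b list set \<Rightarrow> 'b set" where
  "component i I = (\<lambda>x. x ! i) ` I"

definition prod_ideal_compl :: "('b, 'k) ring_scheme list \<Rightarrow> 'b list set \<Rightarrow> 'b list set" where
  "prod_ideal_compl Fs I =
     {x \<in> carrier (RDirProd_list Fs). \<forall>i < length Fs.
        x ! i \<in> (if component i I = {\<zero>\<^bsub>Fs ! i\<^esub>} then carrier (Fs ! i) else {\<zero>\<^bsub>Fs ! i\<^esub>})}"

text \<open>
  The complement of an ideal of a ring \<open>R\<close> that is identified with the product of \<open>Fs\<close> by an
  isomorphism \<open>\<phi>\<close>.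
\<close>

definition ideal_compl ::
  "('a, 'm) ring_scheme \<Rightarrow> ('b, 'k) ring_scheme list \<Rightarrow> ('a \<Rightarrow> 'b list) \<Rightarrow> 'a set \<Rightarrow> 'a set" where
  "ideal_compl R Fs \<phi> I = {r \<in> carrier R. \<phi> r \<in> prod_ideal_compl Fs (\<phi> ` I)}"

end

theory Submission
  imports Defs
begin

text \<open>
  Reading off the nonzero coordinates identifies the ideals of a product of \<open>n\<close> fields with the
  subsets of \<open>{0, \<dots>, n - 1}\<close>, compatibly with inclusions and complements. In the comparability graph
  of the proper nonempty subsets two incomparable sets are joined through their intersection or
  their union unless they are complementary, so distance at most 2 means "not complementary", and
  \<open>n \<ge> 3\<close> bounds all distances by 3. Complementary sets are therefore mutually maximally distant; sets
  \<open>A \<subset> B\<close> never are, because the neighbour \<open>A \<union> B\<^sup>c\<close> of \<open>A\<close> is incomparable to \<open>B\<close>; and all other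
  pairs, at distance 2, are so exactly if no neighbour of one is the complement of the other.
\<close>

section \<open>Distances in a digraph\<close>

context pair_wf_digraph
begin

text \<open>The distance is an infimum of walk lengths, which are natural numbers, so a natural
  bound on it is witnessed by an actual walk. All later statements compare distances with natural
  thresholds and never compute with the infimum.\<close>

lemma graph_dist_le_iff:
  "graph_dist G u v \<le> ereal (real k) \<longleftrightarrow> (\<exists>p. awalk u p v \<and> length p \<le> k)"
proof -
  have dist: "graph_dist G u v = (INF p\<in>{p. awalk u p v}. ereal (real (length p)))"
    by (simp add: graph_dist_def \<mu>_def awalk_cost_def sum_list_triv)
  show ?thesis
  proof
    assume "graph_dist G u v \<le> ereal (real k)"
    \<comment> \<open>A strict upper bound on an infimum is met by a single member; a length below
      \<open>Suc k\<close> is at most \<open>k\<close>.\<close>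
    then have "graph_dist G u v < ereal (real (Suc k))"
      by (rule le_less_trans) simp
    then show "\<exists>p. awalk u p v \<and> length p \<le> k"
      by (auto simp: dist INF_less_iff)
  next
    assume "\<exists>p. awalk u p v \<and> length p \<le> k"
    then show "graph_dist G u v \<le> ereal (real k)"
      by (auto simp: dist intro: INF_lower2)
  qed
qed

text \<open>Walk lengths are integers, so no distance lies strictly between \<open>k\<close> and
  \<open>Suc k\<close>. This turns lower bounds into negated upper bounds.\<close>

lemma graph_dist_ge_Suc_iff:
  "ereal (real (Suc k)) \<le> graph_dist G u v \<longleftrightarrow> \<not> graph_dist G u v \<le> ereal (real k)"
proof
  assume "\<not> graph_dist G u v \<le> ereal (real k)"
  then have "ereal (real (Suc k)) \<le> ereal (real (length p))" if "awalk u p v" for p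
    using that by (auto simp: graph_dist_le_iff not_le)
  then show "ereal (real (Suc k)) \<le> graph_dist G u v"
    by (auto simp: graph_dist_def \<mu>_def awalk_cost_def sum_list_triv intro!: INF_greatest)
next
  assume "ereal (real (Suc k)) \<le> graph_dist G u v"
  moreover have "ereal (real k) < ereal (real (Suc k))"
    by simp
  ultimately show "\<not> graph_dist G u v \<le> ereal (real k)"
    by (metis leD order_less_le_trans)
qed

lemma graph_dist_le_0_iff: "graph_dist G u v \<le> ereal (real 0) \<longleftrightarrow> u = v \<and> u \<in> pverts G"
  by (subst graph_dist_le_iff) (auto simp: awalk_Nil_iff)

text \<open>A walk is empty or has a first arc. This recursion yields the thresholds 1, 2 and 3 one
  after the other.\<close>

lemma graph_dist_le_Suc_iff:
  "graph_dist G u v \<le> ereal (real (Suc k)) \<longleftrightarrow>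
     u = v \<and> u \<in> pverts G \<or> (\<exists>w. (u, w) \<in> parcs G \<and> graph_dist G w v \<le> ereal (real k))"
proof -
  have "(\<exists>p. awalk u p v \<and> length p \<le> Suc k) \<longleftrightarrow>
      awalk u [] v \<or> (\<exists>e p. awalk u (e # p) v \<and> length p \<le> k)"
    by (metis Suc_le_mono length_Cons list.exhaust list.size(3) zero_le)
  also have "\<dots> \<longleftrightarrow> u = v \<and> u \<in> pverts G \<or>
      (\<exists>w. (u, w) \<in> parcs G \<and> (\<exists>p. awalk w p v \<and> length p \<le> k))"
    by (fastforce simp: awalk_Nil_iff awalk_Cons_iff)
  finally show ?thesis
    by (simp only: graph_dist_le_iff)
qed

end


section \<open>The comparability graph of the proper nonempty subsets\<close>

text \<open>These sets stand for the non-trivial ideals: \<open>{}\<close> corresponds to the zero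
  ideal and \<open>X\<close> to the whole ring.\<close>

definition proper_nonempty :: "'x set \<Rightarrow> 'x set \<Rightarrow> bool" where
  "proper_nonempty X A \<longleftrightarrow> A \<noteq> {} \<and> A \<subset> X"

lemma proper_nonempty_compl: "proper_nonempty X A \<Longrightarrow> proper_nonempty X (X - A)"
  unfolding proper_nonempty_def by blast

lemma proper_nonempty_subset: "proper_nonempty X A \<Longrightarrow> A \<subseteq> X"
  unfolding proper_nonempty_def by blast

lemma Diff_psubset_Diff_iff: "\<lbrakk>A \<subseteq> X; B \<subseteq> X\<rbrakk> \<Longrightarrow> X - A \<subset> X - B \<longleftrightarrow> B \<subset> A"
  by blast

text \<open>The vertices are only labelled by subsets through \<open>f\<close>, so the argument
  about sets stays free of ideals and is carried over later by one interpretation.\<close>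

locale subset_comparability_graph = pair_wf_digraph G for G :: "'v pair_pre_digraph" +
  fixes X :: "'x set" and f :: "'x set \<Rightarrow> 'v"
  assumes card_ge_3: "card X \<ge> 3"
    and bij: "bij_betw f {A. proper_nonempty X A} (pverts G)"
    and arc_iff: "\<lbrakk>proper_nonempty X A; proper_nonempty X B\<rbrakk> \<Longrightarrow>
      (f A, f B) \<in> parcs G \<longleftrightarrow> A \<subset> B \<or> B \<subset> A"
begin

abbreviation proper :: "'x set \<Rightarrow> bool" where
  "proper \<equiv> proper_nonempty X"

lemma f_in_pverts: "proper A \<Longrightarrow> f A \<in> pverts G"
  using bij by (auto simp: bij_betw_def)

lemma f_eq_iff: "\<lbrakk>proper A; proper B\<rbrakk> \<Longrightarrow> f A = f B \<longleftrightarrow> A = B"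
  using bij by (auto simp: bij_betw_def dest: inj_onD)

lemma pverts_cases:
  assumes "v \<in> pverts G"
  obtains A where "proper A" "v = f A"
  using assms bij unfolding bij_betw_def by blast

lemma arc_from_iff:
  assumes "proper A"
  shows "(f A, w) \<in> parcs G \<longleftrightarrow> (\<exists>C. proper C \<and> (A \<subset> C \<or> C \<subset> A) \<and> w = f C)"
proof
  assume arc: "(f A, w) \<in> parcs G"
  then have "w \<in> pverts G"
    by (rule in_arcsD2)
  then obtain C where "proper C" "w = f C"
    by (rule pverts_cases)
  with arc show "\<exists>C. proper C \<and> (A \<subset> C \<or> C \<subset> A) \<and> w = f C"
    using arc_iff[OF assms] by blast
next
  assume "\<exists>C. proper C \<and> (A \<subset> C \<or> C \<subset> A) \<and> w = f C"
  then show "(f A, w) \<in> parcs G"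
    using arc_iff[OF assms] by blast
qed

section \<open>Distances up to 3 in terms of inclusion\<close>

lemma dist_le_Suc_iff:
  assumes "proper A" "proper B"
  shows "graph_dist G (f A) (f B) \<le> ereal (real (Suc k)) \<longleftrightarrow>
    A = B \<or> (\<exists>C. proper C \<and> (A \<subset> C \<or> C \<subset> A) \<and> graph_dist G (f C) (f B) \<le> ereal (real k))"
  unfolding graph_dist_le_Suc_iff arc_from_iff[OF assms(1)] f_eq_iff[OF assms]
  using f_in_pverts[OF assms(1)] by blast

lemma dist_le_1_iff:
  assumes A: "proper A" and B: "proper B"
  shows "graph_dist G (f A) (f B) \<le> ereal (real (Suc 0)) \<longleftrightarrow> A \<subseteq> B \<or> B \<subseteq> A"
proof -
  have "graph_dist G (f C) (f B) \<le> ereal (real 0) \<longleftrightarrow> C = B" if "proper C" for C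
    unfolding graph_dist_le_0_iff using f_eq_iff[OF that B] f_in_pverts[OF that] by blast
  then show ?thesis
    unfolding dist_le_Suc_iff[OF A B] using B by blast
qed

text \<open>Conversely to the construction of a middle vertex, nothing lies between \<open>B\<close>
  and its complement: a set comparable to both would contain or be contained in both, hence be
  \<open>X\<close> or \<open>{}\<close>, or would place one of them inside the other and make it
  empty.\<close>

lemma dist_le_2_iff:
  assumes A: "proper A" and B: "proper B"
  shows "graph_dist G (f A) (f B) \<le> ereal (real (Suc (Suc 0))) \<longleftrightarrow> A \<noteq> X - B"
proof -
  have AX: "A \<noteq> {}" "A \<subset> X" and BX: "B \<noteq> {}" "B \<subset> X"
    using A B by (simp_all add: proper_nonempty_def)
  have "graph_dist G (f A) (f B) \<le> ereal (real (Suc (Suc 0))) \<longleftrightarrow>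
      A = B \<or> (\<exists>C. proper C \<and> (A \<subset> C \<or> C \<subset> A) \<and> (C \<subseteq> B \<or> B \<subseteq> C))"
    unfolding dist_le_Suc_iff[OF A B] using dist_le_1_iff[OF _ B] by blast
  also have "\<dots> \<longleftrightarrow> A \<noteq> X - B"
  proof
    assume not_compl: "A \<noteq> X - B"
    \<comment> \<open>Disjoint sets that are not complementary do not cover \<open>X\<close>, so
      their union is a vertex. If the sets meet, their intersection serves instead.\<close>
    have "A \<union> B \<subset> X" if "A \<inter> B = {}"
    proof
      show "A \<union> B \<subseteq> X"
        using AX(2) BX(2) by blast
      show "A \<union> B \<noteq> X"
        using not_compl that by blast
    qed
    then consider "A = B" | "A \<subset> B" | "B \<subset> A" | "A \<union> B \<subset> X" "A \<subset> A \<union> B"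
      | "A \<inter> B \<noteq> {}" "A \<inter> B \<subset> A"
      by (cases "A \<inter> B = {}"; cases "A \<subseteq> B"; cases "B \<subseteq> A") blast+
    then show "A = B \<or> (\<exists>C. proper C \<and> (A \<subset> C \<or> C \<subset> A) \<and> (C \<subseteq> B \<or> B \<subseteq> C))"
    proof cases
      case 4
      then have "proper (A \<union> B)"
        using AX unfolding proper_nonempty_def by blast
      with 4 show ?thesis by blast
    next
      case 5
      then have "proper (A \<inter> B)"
        using AX unfolding proper_nonempty_def by blast
      with 5 show ?thesis by blast
    \<comment> \<open>For strictly comparable sets the middle vertex can be \<open>B\<close>
      itself.\<close>
    qed (use B in blast)+
  next
    assume path: "A = B \<or> (\<exists>C. proper C \<and> (A \<subset> C \<or> C \<subset> A) \<and> (C \<subseteq> B \<or> B \<subseteq> C))"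
    show "A \<noteq> X - B"
    proof
      assume compl: "A = X - B"
      then obtain C where C: "proper C" "A \<subset> C \<or> C \<subset> A" "C \<subseteq> B \<or> B \<subseteq> C"
        using path AX by blast
      then have "C \<noteq> {}" "C \<subset> X"
        by (simp_all add: proper_nonempty_def)
      with C(2,3) show False
        using compl AX by blast
    qed
  qed
  finally show ?thesis .
qed

text \<open>Two neighbours are produced so that one of them avoids any prescribed set. A singleton
  is enlarged to two different pairs, which are proper because \<open>X\<close> has at least three
  elements; a larger set contains two different singletons.\<close>

lemma two_comparable:
  assumes A: "proper A"
  shows "\<exists>C D. proper C \<and> proper D \<and> C \<noteq> D \<and> (A \<subset> C \<or> C \<subset> A) \<and> (A \<subset> D \<or> D \<subset> A)"
proof (cases "\<exists>a. A = {a}")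
  case True
  then obtain a where a: "A = {a}" ..
  \<comment> \<open>With \<open>a\<close> in place of \<open>x\<close> this gives an element other
    than \<open>a\<close>; applied to that element it gives a third one.\<close>
  have "\<not> X \<subseteq> {a, x}" for x
  proof
    assume "X \<subseteq> {a, x}"
    then have "card X \<le> card {a, x}"
      by (intro card_mono) auto
    also have "\<dots> \<le> 2"
      by (simp add: card_insert_if)
    finally show False
      using card_ge_3 by simp
  qed
  then obtain x y where xy: "x \<in> X" "x \<noteq> a" "y \<in> X" "y \<noteq> a" "y \<noteq> x"
    by blast
  then have "proper {a, x}" "proper {a, y}" "{a, x} \<noteq> {a, y}" "A \<subset> {a, x}" "A \<subset> {a, y}"
    using A unfolding a proper_nonempty_def by blast+
  then show ?thesis
    by (intro exI[of _ "{a, x}"] exI[of _ "{a, y}"] conjI disjI1)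
next
  case False
  then obtain x y where xy: "x \<in> A" "y \<in> A" "x \<noteq> y"
    using A unfolding proper_nonempty_def by blast
  then have "proper {x}" "proper {y}" "{x} \<noteq> {y}" "{x} \<subset> A" "{y} \<subset> A"
    using A unfolding proper_nonempty_def by blast+
  then show ?thesis
    by (intro exI[of _ "{x}"] exI[of _ "{y}"] conjI disjI2)
qed

text \<open>One step leads from \<open>A\<close> to a neighbour that is not the complement of
  \<open>B\<close>, and two more steps suffice from there.\<close>

lemma dist_le_3:
  assumes A: "proper A" and B: "proper B"
  shows "graph_dist G (f A) (f B) \<le> ereal (real (Suc (Suc (Suc 0))))"
proof -
  obtain C where "proper C" "A \<subset> C \<or> C \<subset> A" "C \<noteq> X - B"
    using two_comparable[OF A] by metis
  then show ?thesis
    unfolding dist_le_Suc_iff[OF A B] using dist_le_2_iff[OF _ B] by blast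
qed

lemma mutually_maximally_distant_iff:
  assumes A: "proper A" and B: "proper B"
  shows "mutually_maximally_distant G (f A) (f B) \<longleftrightarrow>
    A = X - B \<or> A \<noteq> B \<and> (f A, f B) \<notin> parcs G \<and> (f A, f (X - B)) \<notin> parcs G"
proof -
  have AX: "A \<noteq> {}" "A \<subset> X" and BX: "B \<noteq> {}" "B \<subset> X"
    using A B by (simp_all add: proper_nonempty_def)
  note compl_B = proper_nonempty_compl[OF B]
  let ?d = "\<lambda>A B. graph_dist G (f A) (f B)"
  \<comment> \<open>Quantifiers over neighbours become quantifiers over comparable sets, so the
    definition can be read entirely in terms of sets.\<close>
  have nbhd: "(\<forall>w \<in> neighborhood G (f A). P w) \<longleftrightarrow>
      (\<forall>C. proper C \<longrightarrow> A \<subset> C \<or> C \<subset> A \<longrightarrow> P (f C))" if "proper A" for A P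
    unfolding neighborhood_def arc_from_iff[OF that] by blast
  have mmd: "mutually_maximally_distant G (f A) (f B) \<longleftrightarrow> A \<noteq> B \<and>
      (\<forall>C. proper C \<longrightarrow> A \<subset> C \<or> C \<subset> A \<longrightarrow> ?d B C \<le> ?d A B) \<and>
      (\<forall>C. proper C \<longrightarrow> B \<subset> C \<or> C \<subset> B \<longrightarrow> ?d A C \<le> ?d A B)"
    unfolding mutually_maximally_distant_def nbhd[OF A] nbhd[OF B] f_eq_iff[OF A B]
    using f_in_pverts[OF A] f_in_pverts[OF B] by blast
  consider (compl) "A = X - B" | (eq) "A = B" | (less) "A \<subset> B" | (greater) "B \<subset> A"
    | (incomparable) "A \<noteq> X - B" "\<not> A \<subseteq> B" "\<not> B \<subseteq> A"
    by blast
  then show ?thesis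
  proof cases
    case compl
    \<comment> \<open>Complementary sets attain the largest possible distance 3, so no neighbour can
      be farther away.\<close>
    have "ereal (real (Suc (Suc (Suc 0)))) \<le> ?d A B"
      unfolding graph_dist_ge_Suc_iff dist_le_2_iff[OF A B] using compl by simp
    then have "?d C D \<le> ?d A B" if "proper C" "proper D" for C D
      using dist_le_3[OF that] by (rule order_trans[rotated])
    moreover have "A \<noteq> B"
      using compl AX by blast
    ultimately show ?thesis
      using compl A B mmd by blast
  next
    case eq
    then have "A \<noteq> X - B"
      using AX by blast
    with eq show ?thesis
      using mmd by blast
  next
    case less
    \<comment> \<open>This set omits the nonempty \<open>B - A\<close>, so it is proper and does not
      contain \<open>B\<close>; it is not inside \<open>B\<close> since it contains the nonempty
      \<open>X - B\<close>. Hence it is a neighbour of \<open>A\<close> at distance greater than 1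
      from \<open>B\<close>.\<close>
    let ?C = "A \<union> (X - B)"
    have "?C \<noteq> {}" "?C \<subset> X" and C: "A \<subset> ?C" "\<not> ?C \<subseteq> B" "\<not> B \<subseteq> ?C"
      using less AX BX by blast+
    then have "proper ?C"
      unfolding proper_nonempty_def by (intro conjI)
    then have "?d A B \<le> ereal (real (Suc 0))" "\<not> ?d B ?C \<le> ereal (real (Suc 0))"
      using less C dist_le_1_iff[OF A B] dist_le_1_iff[OF B, of ?C] by blast+
    then have "\<not> ?d B ?C \<le> ?d A B"
      by (meson order_trans)
    then have "\<not> mutually_maximally_distant G (f A) (f B)"
      using C(1) \<open>proper ?C\<close> mmd by blast
    moreover have "A \<noteq> X - B"
      using less AX by blast
    ultimately show ?thesis
      using less arc_iff[OF A B] by blast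
  next
    case greater
    \<comment> \<open>The same witness with the roles exchanged: a neighbour of \<open>B\<close>
      that is too far from \<open>A\<close>.\<close>
    let ?C = "B \<union> (X - A)"
    have "?C \<noteq> {}" "?C \<subset> X" and C: "B \<subset> ?C" "\<not> ?C \<subseteq> A" "\<not> A \<subseteq> ?C"
      using greater AX BX by blast+
    then have "proper ?C"
      unfolding proper_nonempty_def by (intro conjI)
    then have "?d A B \<le> ereal (real (Suc 0))" "\<not> ?d A ?C \<le> ereal (real (Suc 0))"
      using greater C dist_le_1_iff[OF A B] dist_le_1_iff[OF A, of ?C] by blast+
    then have "\<not> ?d A ?C \<le> ?d A B"
      by (meson order_trans)
    then have "\<not> mutually_maximally_distant G (f A) (f B)"
      using C(1) \<open>proper ?C\<close> mmd by blast
    moreover have "A \<noteq> X - B"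
      using greater BX by blast
    ultimately show ?thesis
      using greater arc_iff[OF A B] by blast
  next
    case incomparable
    have le: "?d A B \<le> ereal (real (Suc (Suc 0)))"
      unfolding dist_le_2_iff[OF A B] by (rule incomparable)
    have ge: "ereal (real (Suc (Suc 0))) \<le> ?d A B"
      unfolding graph_dist_ge_Suc_iff dist_le_1_iff[OF A B] using incomparable by blast
    \<comment> \<open>As \<open>A\<close> and \<open>B\<close> are at distance exactly 2, a pair is
      farther apart precisely if it is complementary.\<close>
    have two: "?d C D \<le> ?d A B \<longleftrightarrow> C \<noteq> X - D" if "proper C" "proper D" for C D
      using dist_le_2_iff[OF that] le ge by (meson order_trans)
    have "mutually_maximally_distant G (f A) (f B) \<longleftrightarrow> \<not> (A \<subset> X - B \<or> X - B \<subset> A)"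
    proof
      assume "mutually_maximally_distant G (f A) (f B)"
      \<comment> \<open>If \<open>X - B\<close> were a neighbour of \<open>A\<close>, maximality
        would bound its distance from \<open>B\<close> by 2, although the two are
        complementary.\<close>
      then have "?d B (X - B) \<le> ?d A B" if "A \<subset> X - B \<or> X - B \<subset> A"
        using mmd compl_B that by blast
      moreover have "B = X - (X - B)"
        using BX by blast
      ultimately show "\<not> (A \<subset> X - B \<or> X - B \<subset> A)"
        using two[OF B compl_B] by blast
    next
      assume not_adj: "\<not> (A \<subset> X - B \<or> X - B \<subset> A)"
      have "?d B C \<le> ?d A B" if C: "proper C" "A \<subset> C \<or> C \<subset> A" for C
      proof -
        have "B \<noteq> X - C"
          using C(2) not_adj proper_nonempty_subset[OF C(1)] by (metis double_diff subset_refl)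
        then show ?thesis
          using two[OF B C(1)] by blast
      qed
      moreover have "?d A C \<le> ?d A B" if C: "proper C" "B \<subset> C \<or> C \<subset> B" for C
      proof -
        \<comment> \<open>Complementation reverses inclusion: if \<open>C\<close> is comparable to
          \<open>B\<close>, then \<open>X - C\<close> is comparable to \<open>X - B\<close>, which
          \<open>A\<close> is not.\<close>
        have "A \<noteq> X - C"
          using C not_adj B Diff_psubset_Diff_iff proper_nonempty_subset by metis
        then show ?thesis
          using two[OF A C(1)] by blast
      qed
      ultimately show "mutually_maximally_distant G (f A) (f B)"
        using mmd incomparable by blast
    qed
    then show ?thesis
      using incomparable arc_iff[OF A B] arc_iff[OF A compl_B] by blast
  qed
qed

text \<open>Every vertex has its complement as a mutually maximally distant partner.\<close>

lemma pverts_strong_resolving_graph: "pverts (strong_resolving_graph G) = pverts G"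
proof -
  have "\<exists>v \<in> pverts G. mutually_maximally_distant G u v" if u: "u \<in> pverts G" for u
  proof -
    obtain A where A: "proper A" "u = f A"
      using u by (rule pverts_cases)
    have "A = X - (X - A)"
      using proper_nonempty_subset[OF A(1)] by blast
    then have "mutually_maximally_distant G (f A) (f (X - A))"
      using mutually_maximally_distant_iff[OF A(1) proper_nonempty_compl[OF A(1)]] by blast
    then show ?thesis
      using A proper_nonempty_compl f_in_pverts by blast
  qed
  then show ?thesis
    by (auto simp: strong_resolving_graph_def)
qed

end


section \<open>Ideals of a finite product of fields\<close>

text \<open>Consing is a homomorphism from the binary product of \<open>R\<close> with the product
  of \<open>Rs\<close>, where the operations are componentwise.\<close>

lemma RDirProd_list_Cons_simps:
  assumes "a \<in> carrier R" "b \<in> carrier R"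
    and "as \<in> carrier (RDirProd_list Rs)" "bs \<in> carrier (RDirProd_list Rs)"
  shows "(a # as) \<oplus>\<^bsub>RDirProd_list (R # Rs)\<^esub> (b # bs) =
      (a \<oplus>\<^bsub>R\<^esub> b) # (as \<oplus>\<^bsub>RDirProd_list Rs\<^esub> bs)"
    and "(a # as) \<otimes>\<^bsub>RDirProd_list (R # Rs)\<^esub> (b # bs) =
      (a \<otimes>\<^bsub>R\<^esub> b) # (as \<otimes>\<^bsub>RDirProd_list Rs\<^esub> bs)"
  using assms ring_hom_mult[OF RDirProd_list_hom1, of "(a, as)" R Rs "(b, bs)"]
    ring_hom_add[OF RDirProd_list_hom1, of "(a, as)" R Rs "(b, bs)"]
  by (auto simp: RDirProd_carrier) (auto simp: RDirProd_def DirProd_def monoid.defs)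

lemma RDirProd_list_one_nth: "i < length Rs \<Longrightarrow> \<one>\<^bsub>RDirProd_list Rs\<^esub> ! i = \<one>\<^bsub>Rs ! i\<^esub>"
  unfolding RDirProd_list_one by (induct Rs arbitrary: i) (auto simp: nth_Cons split: nat.split)

lemma RDirProd_list_nth_hom:
  "i < length Rs \<Longrightarrow> (\<lambda>x. x ! i) \<in> ring_hom (RDirProd_list Rs) (Rs ! i)"
proof (rule ring_hom_memI)
  fix x y
  assume "x \<in> carrier (RDirProd_list Rs)" "y \<in> carrier (RDirProd_list Rs)" and "i < length Rs"
  then have "(x \<oplus>\<^bsub>RDirProd_list Rs\<^esub> y) ! i = x ! i \<oplus>\<^bsub>Rs ! i\<^esub> y ! i \<and>
      (x \<otimes>\<^bsub>RDirProd_list Rs\<^esub> y) ! i = x ! i \<otimes>\<^bsub>Rs ! i\<^esub> y ! i"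
    by (induct Rs arbitrary: x y i)
      (auto simp: RDirProd_list_carrier RDirProd_list_Cons_simps nth_Cons split: nat.split)
  then show "(x \<otimes>\<^bsub>RDirProd_list Rs\<^esub> y) ! i = x ! i \<otimes>\<^bsub>Rs ! i\<^esub> y ! i"
    and "(x \<oplus>\<^bsub>RDirProd_list Rs\<^esub> y) ! i = x ! i \<oplus>\<^bsub>Rs ! i\<^esub> y ! i"
    by auto
qed (auto simp: RDirProd_list_carrier_mem RDirProd_list_one_nth)

section \<open>Ideals of the product described by their supports\<close>

locale field_product = R?: cring R for R :: "('a, 'm) ring_scheme" (structure) +
  fixes Fs :: "('b, 'k) ring_scheme list" and \<phi> :: "'a \<Rightarrow> 'b list"
  assumes fields: "i < length Fs \<Longrightarrow> field (Fs ! i)"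
    and iso: "\<phi> \<in> ring_iso R (RDirProd_list Fs)"
begin

definition support :: "'a set \<Rightarrow> nat set" where
  "support I = {i. i < length Fs \<and> (\<exists>r\<in>I. \<phi> r ! i \<noteq> \<zero>\<^bsub>Fs ! i\<^esub>)}"

text \<open>The preimage under \<open>\<phi>\<close> of the product ideal whose factor is the whole
  field at the indices in \<open>A\<close> and zero at the others.\<close>

definition supported_ideal :: "nat set \<Rightarrow> 'a set" where
  "supported_ideal A = {r \<in> carrier R. \<forall>i < length Fs. i \<notin> A \<longrightarrow> \<phi> r ! i = \<zero>\<^bsub>Fs ! i\<^esub>}"

lemma coordinate_hom:
  assumes "i < length Fs"
  shows "ring_hom_ring R (Fs ! i) (\<lambda>r. \<phi> r ! i)"
proof -
  interpret F: field "Fs ! i"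
    using assms by (rule fields)
  have "(\<lambda>x. x ! i) \<circ> \<phi> \<in> ring_hom R (Fs ! i)"
    using iso RDirProd_list_nth_hom[OF assms] by (auto simp: ring_iso_def intro: ring_hom_trans)
  then show ?thesis
    by (intro ring_hom_ringI2 R.ring_axioms F.ring_axioms) (simp add: comp_def)
qed

lemma coordinate_simps:
  assumes "i < length Fs"
  shows "r \<in> carrier R \<Longrightarrow> \<phi> r ! i \<in> carrier (Fs ! i)"
    and "\<phi> \<zero> ! i = \<zero>\<^bsub>Fs ! i\<^esub>" and "\<phi> \<one> ! i = \<one>\<^bsub>Fs ! i\<^esub>"
    and "\<lbrakk>r \<in> carrier R; s \<in> carrier R\<rbrakk> \<Longrightarrow> \<phi> (r \<oplus> s) ! i = \<phi> r ! i \<oplus>\<^bsub>Fs ! i\<^esub> \<phi> s ! i"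
    and "\<lbrakk>r \<in> carrier R; s \<in> carrier R\<rbrakk> \<Longrightarrow> \<phi> (r \<otimes> s) ! i = \<phi> r ! i \<otimes>\<^bsub>Fs ! i\<^esub> \<phi> s ! i"
    and "\<one>\<^bsub>Fs ! i\<^esub> \<noteq> \<zero>\<^bsub>Fs ! i\<^esub>" and "\<zero>\<^bsub>Fs ! i\<^esub> \<in> carrier (Fs ! i)"
    and "\<one>\<^bsub>Fs ! i\<^esub> \<in> carrier (Fs ! i)"
    and "a \<in> carrier (Fs ! i) \<Longrightarrow> \<zero>\<^bsub>Fs ! i\<^esub> \<oplus>\<^bsub>Fs ! i\<^esub> a = a"
    and "a \<in> carrier (Fs ! i) \<Longrightarrow> a \<oplus>\<^bsub>Fs ! i\<^esub> \<zero>\<^bsub>Fs ! i\<^esub> = a"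
proof -
  interpret ring_hom_ring R "Fs ! i" "\<lambda>r. \<phi> r ! i"
    using assms by (rule coordinate_hom)
  interpret F: field "Fs ! i"
    using assms by (rule fields)
  show "r \<in> carrier R \<Longrightarrow> \<phi> r ! i \<in> carrier (Fs ! i)"
    and "\<phi> \<zero> ! i = \<zero>\<^bsub>Fs ! i\<^esub>" and "\<phi> \<one> ! i = \<one>\<^bsub>Fs ! i\<^esub>"
    and "\<lbrakk>r \<in> carrier R; s \<in> carrier R\<rbrakk> \<Longrightarrow> \<phi> (r \<oplus> s) ! i = \<phi> r ! i \<oplus>\<^bsub>Fs ! i\<^esub> \<phi> s ! i"
    and "\<lbrakk>r \<in> carrier R; s \<in> carrier R\<rbrakk> \<Longrightarrow> \<phi> (r \<otimes> s) ! i = \<phi> r ! i \<otimes>\<^bsub>Fs ! i\<^esub> \<phi> s ! i"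
    and "\<one>\<^bsub>Fs ! i\<^esub> \<noteq> \<zero>\<^bsub>Fs ! i\<^esub>" and "\<zero>\<^bsub>Fs ! i\<^esub> \<in> carrier (Fs ! i)"
    and "\<one>\<^bsub>Fs ! i\<^esub> \<in> carrier (Fs ! i)"
    and "a \<in> carrier (Fs ! i) \<Longrightarrow> \<zero>\<^bsub>Fs ! i\<^esub> \<oplus>\<^bsub>Fs ! i\<^esub> a = a"
    and "a \<in> carrier (Fs ! i) \<Longrightarrow> a \<oplus>\<^bsub>Fs ! i\<^esub> \<zero>\<^bsub>Fs ! i\<^esub> = a"
    by simp_all
qed

lemma coordinates_eqI:
  assumes "r \<in> carrier R" "s \<in> carrier R" "\<And>i. i < length Fs \<Longrightarrow> \<phi> r ! i = \<phi> s ! i"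
  shows "r = s"
proof -
  have "\<phi> r \<in> carrier (RDirProd_list Fs)" "\<phi> s \<in> carrier (RDirProd_list Fs)"
    using iso assms by (auto dest: ring_iso_memE(1))
  then have "length (\<phi> r) = length Fs" "length (\<phi> s) = length Fs"
    by (simp_all add: RDirProd_list_carrier_mem(1))
  then have "\<phi> r = \<phi> s"
    using assms(3) by (simp add: list_eq_iff_nth_eq)
  then show ?thesis
    using iso assms by (auto simp: ring_iso_def bij_betw_def dest: inj_onD)
qed

text \<open>Surjectivity of \<open>\<phi>\<close> in the form used below: coordinates may be
  prescribed freely.\<close>

lemma obtain_coordinates:
  assumes "\<And>i. i < length Fs \<Longrightarrow> x i \<in> carrier (Fs ! i)"
  obtains r where "r \<in> carrier R" "\<And>i. i < length Fs \<Longrightarrow> \<phi> r ! i = x i"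
proof -
  have "map x [0..<length Fs] \<in> carrier (RDirProd_list Fs)"
    using assms by (intro RDirProd_list_carrier_memI) auto
  also have "carrier (RDirProd_list Fs) = \<phi> ` carrier R"
    using iso by (simp add: ring_iso_def bij_betw_def)
  finally obtain r where "r \<in> carrier R" "\<phi> r = map x [0..<length Fs]"
    by (metis imageE)
  then show ?thesis
    by (intro that[of r]) auto
qed

text \<open>It is the intersection of the kernels of the coordinate maps outside
  \<open>A\<close>.\<close>

lemma ideal_supported_ideal: "ideal (supported_ideal A) R"
proof -
  \<comment> \<open>Intersecting with the carrier makes the empty family of kernels give the whole
    ring instead of the universe of the type.\<close>
  have "ideal (carrier R \<inter> (\<Inter>i \<in> {i. i < length Fs \<and> i \<notin> A}. a_kernel R (Fs ! i) (\<lambda>r. \<phi> r ! i))) R"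
  proof (cases "{i. i < length Fs \<and> i \<notin> A} = {}")
    case True
    then show ?thesis
      using R.oneideal by (simp only: INF_empty Int_UNIV_right)
  next
    case False
    then have "ideal (\<Inter>i \<in> {i. i < length Fs \<and> i \<notin> A}. a_kernel R (Fs ! i) (\<lambda>r. \<phi> r ! i)) R"
      by (intro R.i_Intersect) (auto intro: ring_hom_ring.kernel_is_ideal coordinate_hom)
    then show ?thesis
      by (rule R.i_intersect[OF R.oneideal])
  qed
  also have "carrier R \<inter> (\<Inter>i \<in> {i. i < length Fs \<and> i \<notin> A}. a_kernel R (Fs ! i) (\<lambda>r. \<phi> r ! i)) =
      supported_ideal A"
    by (auto simp: supported_ideal_def a_kernel_def')
  finally show ?thesis .
qed

lemma support_supported_ideal:
  assumes "A \<subseteq> {..<length Fs}"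
  shows "support (supported_ideal A) = A"
proof
  show "A \<subseteq> support (supported_ideal A)"
  proof
    fix i assume i: "i \<in> A"
    \<comment> \<open>The indicator element of \<open>A\<close> is nonzero at every index in
      \<open>A\<close>, since one differs from zero in a field.\<close>
    obtain r where r: "r \<in> carrier R"
      "\<And>j. j < length Fs \<Longrightarrow> \<phi> r ! j = (if j \<in> A then \<one>\<^bsub>Fs ! j\<^esub> else \<zero>\<^bsub>Fs ! j\<^esub>)"
      by (rule obtain_coordinates[of "\<lambda>j. if j \<in> A then \<one>\<^bsub>Fs ! j\<^esub> else \<zero>\<^bsub>Fs ! j\<^esub>"])
        (auto simp: coordinate_simps)
    then have "r \<in> supported_ideal A" "\<phi> r ! i \<noteq> \<zero>\<^bsub>Fs ! i\<^esub>" "i < length Fs"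
      using i assms by (auto simp: supported_ideal_def coordinate_simps)
    then show "i \<in> support (supported_ideal A)"
      by (auto simp: support_def)
  qed
qed (auto simp: support_def supported_ideal_def)

text \<open>This is where division is used: an element of \<open>I\<close> that is nonzero at
  \<open>i\<close> is multiplied by one concentrated at \<open>i\<close>, which clears all other
  coordinates and rescales the remaining one to \<open>a\<close>.\<close>

lemma single_coordinate_mem_ideal:
  assumes I: "ideal I R" and i: "i \<in> support I" and a: "a \<in> carrier (Fs ! i)"
  obtains s where "s \<in> I"
    "\<And>j. j < length Fs \<Longrightarrow> \<phi> s ! j = (if j = i then a else \<zero>\<^bsub>Fs ! j\<^esub>)"
proof -
  interpret I: ideal I R by fact
  obtain t where t: "t \<in> I" "\<phi> t ! i \<noteq> \<zero>\<^bsub>Fs ! i\<^esub>" and i_less: "i < length Fs"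
    using i by (auto simp: support_def)
  have t_carr: "t \<in> carrier R"
    using t(1) by (rule I.Icarr)
  interpret F: field "Fs ! i"
    using i_less by (rule fields)
  have unit: "\<phi> t ! i \<in> Units (Fs ! i)"
    using t t_carr i_less by (simp add: F.field_Units coordinate_simps)
  let ?c = "a \<otimes>\<^bsub>Fs ! i\<^esub> inv\<^bsub>Fs ! i\<^esub> (\<phi> t ! i)"
  obtain c where c: "c \<in> carrier R"
    "\<And>j. j < length Fs \<Longrightarrow> \<phi> c ! j = (if j = i then ?c else \<zero>\<^bsub>Fs ! j\<^esub>)"
    by (rule obtain_coordinates[of "\<lambda>j. if j = i then ?c else \<zero>\<^bsub>Fs ! j\<^esub>"])
      (use a unit in \<open>auto simp: coordinate_simps\<close>)
  have "\<phi> (c \<otimes> t) ! j = (if j = i then a else \<zero>\<^bsub>Fs ! j\<^esub>)" if j: "j < length Fs" for j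
  proof -
    interpret Fj: field "Fs ! j"
      using j by (rule fields)
    show ?thesis
      using c j t_carr a unit by (auto simp: coordinate_simps F.m_assoc)
  qed
  moreover have "c \<otimes> t \<in> I"
    using t(1) c(1) by (rule I.I_l_closed)
  ultimately show ?thesis
    by (rule that[rotated])
qed

text \<open>The classification of ideals: each is the product of the full factors on its support and
  of zeros elsewhere.\<close>

lemma supported_ideal_support:
  assumes I: "ideal I R"
  shows "supported_ideal (support I) = I"
proof
  interpret I: ideal I R by fact
  show "supported_ideal (support I) \<subseteq> I"
  proof
    fix r assume "r \<in> supported_ideal (support I)"
    then have r: "r \<in> carrier R" "\<And>i. i < length Fs \<Longrightarrow> i \<notin> support I \<Longrightarrow> \<phi> r ! i = \<zero>\<^bsub>Fs ! i\<^esub>"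
      by (auto simp: supported_ideal_def)
    \<comment> \<open>\<open>r\<close> is the sum of its coordinates, which are added one at a time.\<close>
    have "\<exists>s\<in>I. \<forall>i < length Fs. \<phi> s ! i = (if i < m then \<phi> r ! i else \<zero>\<^bsub>Fs ! i\<^esub>)"
      if "m \<le> length Fs" for m
      using that
    proof (induct m)
      case 0
      show ?case
        by (rule bexI[of _ \<zero>]) (auto simp: coordinate_simps)
    next
      case (Suc m)
      then obtain s where s: "s \<in> I"
        "\<And>i. i < length Fs \<Longrightarrow> \<phi> s ! i = (if i < m then \<phi> r ! i else \<zero>\<^bsub>Fs ! i\<^esub>)"
        by auto
      show ?case
      proof (cases "m \<in> support I")
        case True
        have "\<phi> r ! m \<in> carrier (Fs ! m)"
          using Suc r by (simp add: coordinate_simps)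
        then obtain t where t: "t \<in> I"
          "\<And>i. i < length Fs \<Longrightarrow> \<phi> t ! i = (if i = m then \<phi> r ! m else \<zero>\<^bsub>Fs ! i\<^esub>)"
          by (rule single_coordinate_mem_ideal[OF I True]) blast
        have "\<phi> (s \<oplus> t) ! i = (if i < Suc m then \<phi> r ! i else \<zero>\<^bsub>Fs ! i\<^esub>)" if i: "i < length Fs" for i
          using s t i r I.Icarr by (auto simp: coordinate_simps less_Suc_eq)
        then show ?thesis
          using I.a_closed[OF s(1) t(1)] by blast
      next
        case False
        \<comment> \<open>Outside the support \<open>r\<close> has coordinate zero at
          \<open>m\<close>, so \<open>s\<close> already has the required coordinates.\<close>
        then show ?thesis
          using s r Suc by (intro bexI[of _ s]) (auto simp: less_Suc_eq)
      qed
    qed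
    from this[of "length Fs"] obtain s
      where s: "s \<in> I" "\<And>i. i < length Fs \<Longrightarrow> \<phi> s ! i = \<phi> r ! i"
      by auto
    then have "s = r"
      using r I.Icarr by (intro coordinates_eqI)
    with s show "r \<in> I" by simp
  qed
  show "I \<subseteq> supported_ideal (support I)"
    using I.Icarr by (auto simp: supported_ideal_def support_def)
qed

text \<open>\<open>support\<close> is monotone and recovers the index set, so inclusions are
  reflected as well as preserved.\<close>

lemma supported_ideal_subset_iff:
  assumes "A \<subseteq> {..<length Fs}" "B \<subseteq> {..<length Fs}"
  shows "supported_ideal A \<subseteq> supported_ideal B \<longleftrightarrow> A \<subseteq> B"
proof
  assume "supported_ideal A \<subseteq> supported_ideal B"
  then have "support (supported_ideal A) \<subseteq> support (supported_ideal B)"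
    by (auto simp: support_def)
  then show "A \<subseteq> B"
    using assms by (simp add: support_supported_ideal)
qed (auto simp: supported_ideal_def)

lemma supported_ideal_psubset_iff:
  assumes "A \<subseteq> {..<length Fs}" "B \<subseteq> {..<length Fs}"
  shows "supported_ideal A \<subset> supported_ideal B \<longleftrightarrow> A \<subset> B"
  using assms by (simp add: less_le_not_le supported_ideal_subset_iff)

lemma supported_ideal_empty: "supported_ideal {} = {\<zero>}"
  by (auto simp: supported_ideal_def coordinate_simps intro: coordinates_eqI)

lemma supported_ideal_all: "supported_ideal {..<length Fs} = carrier R"
  by (auto simp: supported_ideal_def)

lemma supported_ideal_inj:
  "\<lbrakk>A \<subseteq> {..<length Fs}; B \<subseteq> {..<length Fs}\<rbrakk> \<Longrightarrow> supported_ideal A = supported_ideal B \<longleftrightarrow> A = B"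
  by (metis support_supported_ideal)

lemma support_subset: "support I \<subseteq> {..<length Fs}"
  by (auto simp: support_def)

section \<open>The inclusion ideal graph in terms of index sets\<close>

lemma bij_betw_supported_ideal:
  "bij_betw supported_ideal {A. proper_nonempty {..<length Fs} A} (pverts (inclusion_ideal_graph R))"
proof (rule bij_betw_imageI)
  show "inj_on supported_ideal {A. proper_nonempty {..<length Fs} A}"
    by (auto intro!: inj_onI simp: supported_ideal_inj proper_nonempty_subset)
  \<comment> \<open>The two trivial ideals come from \<open>{}\<close> and from the full index set,
    and by injectivity from no other index set.\<close>
  have vertex_iff: "supported_ideal A \<in> pverts (inclusion_ideal_graph R) \<longleftrightarrow>
      proper_nonempty {..<length Fs} A" if "A \<subseteq> {..<length Fs}" for A
    using that supported_ideal_inj[of A "{}"] supported_ideal_inj[of A "{..<length Fs}"]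
    by (simp add: inclusion_ideal_graph_def Let_def ideal_supported_ideal
        supported_ideal_empty supported_ideal_all proper_nonempty_def psubset_eq)
  show "supported_ideal ` {A. proper_nonempty {..<length Fs} A} = pverts (inclusion_ideal_graph R)"
  proof (intro subset_antisym subsetI)
    fix I assume I: "I \<in> pverts (inclusion_ideal_graph R)"
    then have "supported_ideal (support I) = I"
      by (simp add: inclusion_ideal_graph_def Let_def supported_ideal_support)
    with I show "I \<in> supported_ideal ` {A. proper_nonempty {..<length Fs} A}"
      using vertex_iff[OF support_subset] by (metis imageI mem_Collect_eq)
  next
    fix I assume "I \<in> supported_ideal ` {A. proper_nonempty {..<length Fs} A}"
    then show "I \<in> pverts (inclusion_ideal_graph R)"
      using vertex_iff proper_nonempty_subset by blast
  qed
qed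

lemma component_supported_ideal_eq_zero_iff:
  assumes A: "A \<subseteq> {..<length Fs}" and i: "i < length Fs"
  shows "component i (\<phi> ` supported_ideal A) = {\<zero>\<^bsub>Fs ! i\<^esub>} \<longleftrightarrow> i \<notin> A"
proof -
  interpret ideal "supported_ideal A" R
    by (rule ideal_supported_ideal)
  \<comment> \<open>Since a component always contains zero, it equals the zero set as soon as it has
    no nonzero element.\<close>
  have "\<zero>\<^bsub>Fs ! i\<^esub> \<in> component i (\<phi> ` supported_ideal A)"
    using i by (auto simp: component_def image_image coordinate_simps intro!: image_eqI[of _ _ \<zero>])
  then have "component i (\<phi> ` supported_ideal A) = {\<zero>\<^bsub>Fs ! i\<^esub>} \<longleftrightarrow> i \<notin> support (supported_ideal A)"
    using i by (auto simp: component_def support_def)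
  then show ?thesis
    using A by (simp add: support_supported_ideal)
qed

text \<open>The complement forces the coordinates in \<open>A\<close> to vanish and leaves the
  others free, so complements of ideals become complements of index sets.\<close>

lemma ideal_compl_supported_ideal:
  assumes A: "A \<subseteq> {..<length Fs}"
  shows "ideal_compl R Fs \<phi> (supported_ideal A) = supported_ideal ({..<length Fs} - A)"
  using iso ring_iso_memE(1)[OF iso]
  by (auto simp: ideal_compl_def prod_ideal_compl_def supported_ideal_def[of "{..<length Fs} - A"]
      component_supported_ideal_eq_zero_iff[OF A] coordinate_simps)

lemma subset_comparability_graph_inclusion_ideal_graph:
  assumes "length Fs \<ge> 3"
  shows "subset_comparability_graph (inclusion_ideal_graph R) {..<length Fs} supported_ideal"
proof -
  interpret pair_bidirected_digraph "inclusion_ideal_graph R"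
    by (rule pair_bidirected_digraph_inclusion_ideal_graph)
  show ?thesis
  proof
    fix A B assume "proper_nonempty {..<length Fs} A" "proper_nonempty {..<length Fs} B"
    moreover from this have "supported_ideal A \<in> pverts (inclusion_ideal_graph R)"
      "supported_ideal B \<in> pverts (inclusion_ideal_graph R)"
      using bij_betw_supported_ideal by (auto simp: bij_betw_def)
    ultimately show "(supported_ideal A, supported_ideal B) \<in> parcs (inclusion_ideal_graph R) \<longleftrightarrow>
        A \<subset> B \<or> B \<subset> A"
      by (simp add: inclusion_ideal_graph_def Let_def supported_ideal_psubset_iff
          proper_nonempty_subset)
  qed (use assms bij_betw_supported_ideal in auto)
qed

end

theorem lemma2p4:
  fixes n :: nat
    and R :: "('a, 'm) ring_scheme"
    and Fs :: "('b, 'k) ring_scheme list"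
    and \<phi> :: "'a \<Rightarrow> 'b list"
  assumes "n \<ge> 3"
    and "cring R"
    and "length Fs = n"
    and "\<And>i. i < n \<Longrightarrow> field (Fs ! i)"
    and "\<phi> \<in> ring_iso R (RDirProd_list Fs)"
  shows "pverts (inclusion_ideal_graph R) = pverts (strong_resolving_graph (inclusion_ideal_graph R))
    \<and> (\<forall>I \<in> pverts (strong_resolving_graph (inclusion_ideal_graph R)).
       \<forall>J \<in> pverts (strong_resolving_graph (inclusion_ideal_graph R)). I \<noteq> J \<longrightarrow>
         ((I, J) \<in> parcs (strong_resolving_graph (inclusion_ideal_graph R)) \<longleftrightarrow>
            I = ideal_compl R Fs \<phi> J \<or>
            ((I, J) \<notin> parcs (inclusion_ideal_graph R) \<and>
             (I, ideal_compl R Fs \<phi> J) \<notin> parcs (inclusion_ideal_graph R))))"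
proof -
  interpret field_product R Fs \<phi>
    using assms by (auto simp: field_product_def field_product_axioms_def)
  interpret G: subset_comparability_graph "inclusion_ideal_graph R" "{..<length Fs}" supported_ideal
    using assms by (intro subset_comparability_graph_inclusion_ideal_graph) simp
  \<comment> \<open>Both graphs have the same vertices, so the equivalence is proved for vertices of
    the inclusion ideal graph.\<close>
  have "(I, J) \<in> parcs (strong_resolving_graph (inclusion_ideal_graph R)) \<longleftrightarrow>
      I = ideal_compl R Fs \<phi> J \<or>
      (I, J) \<notin> parcs (inclusion_ideal_graph R) \<and>
      (I, ideal_compl R Fs \<phi> J) \<notin> parcs (inclusion_ideal_graph R)"
    if IJ: "I \<in> pverts (inclusion_ideal_graph R)" "J \<in> pverts (inclusion_ideal_graph R)" "I \<noteq> J"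
    for I J
  proof -
    obtain A where A: "proper_nonempty {..<length Fs} A" "I = supported_ideal A"
      using IJ(1) by (rule G.pverts_cases)
    obtain B where B: "proper_nonempty {..<length Fs} B" "J = supported_ideal B"
      using IJ(2) by (rule G.pverts_cases)
    have compl: "ideal_compl R Fs \<phi> J = supported_ideal ({..<length Fs} - B)"
      using B by (simp add: ideal_compl_supported_ideal proper_nonempty_subset)
    have "I = ideal_compl R Fs \<phi> J \<longleftrightarrow> A = {..<length Fs} - B"
      using A by (simp add: compl supported_ideal_inj proper_nonempty_subset)
    \<comment> \<open>Distinctness of the ideals discharges the clause \<open>A \<noteq> B\<close>
      of the criterion for sets.\<close>
    moreover have "A \<noteq> B"
      using IJ(3) A B by blast
    ultimately show ?thesis
      using G.mutually_maximally_distant_iff[OF A(1) B(1)] A(2) B(2) compl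
      by (simp add: strong_resolving_graph_def)
  qed
  then show ?thesis
    by (simp add: G.pverts_strong_resolving_graph)
qed

end
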